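(* Let $\mathbb{F}_q$ be a finite field and let $L, N$ be positive integers. For each $\ell \in [L] = \{1,\dots,L\}$ let $(\mathcal{C}_\ell, \mathcal{C}_\ell^{\mathrm{noise}})$ and $(\mathcal{D}_\ell, \mathcal{D}_\ell^{\mathrm{noise}})$ be linear secret sharing schemes over $\mathbb{F}_q$ with $N$ parties such that $\dim(\mathcal{C}_\ell) = \dim(\mathcal{D}_\ell) = 1$. Define $$\mathcal{E} = \sum_{\ell \in [L]} \mathcal{C}_\ell \star \mathcal{D}_\ell, \qquad \mathcal{E}^{\mathrm{noise}} = \sum_{\ell \in [L]} \big( \mathcal{C}_\ell \star \mathcal{D}_\ell^{\mathrm{noise}} + \mathcal{C}_\ell^{\mathrm{noise}} \star \mathcal{D}_\ell + \mathcal{C}_\ell^{\mathrm{noise}} \star \mathcal{D}_\ell^{\mathrm{noise}} \big).$$ Suppose that $\mathcal{E} \cap \mathcal{E}^{\mathrm{noise}} = 0$ and $\dim(\mathcal{E}) = L$. Then there exists a PIR scheme over $\mathbb{F}_q$ (with $N$ servers and $L$ fragments per file) with rate $\mathcal{R} = \tfrac{L}{N}$ which is $X$-secure for $X = \min_{\ell} d^\perp(\mathcal{C}_\ell^{\mathrm{noise}}) - 1$ and $T$-private for $T = \min_\ell d^\perp(\mathcal{D}_\ell^{\mathrm{noise}}) - 1$.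
   Context: Codes. A (linear) code of length $N$ is an $\mathbb{F}_q$-subspace of $\mathbb{F}_q^N$; the $n$th coordinate of $c$ is written $c(n)$. For a code $\mathcal{C}$, $\mathcal{C}^\perp$ is its dual with respect to the standard inner product and $d^\perp(\mathcal{C})$ is the minimum Hamming distance of $\mathcal{C}^\perp$. For $c,d\in\mathbb{F}_q^N$, $c \star d = (c(1)d(1),\dots,c(N)d(N))$, and for codes $\mathcal{C} \star \mathcal{D} = \mathrm{span}_{\mathbb{F}_q}\{c\star d \mid c\in\mathcal{C}, d\in\mathcal{D}\}$. Linear secret sharing schemes. A linear secret sharing scheme (LSSS) over $\mathbb{F}_q$ with $N$ parties is a pair $(\mathcal{C},\mathcal{C}^{\mathrm{noise}})$ of linear codes in $\mathbb{F}_q^N$ with $\mathcal{C}\cap\mathcal{C}^{\mathrm{noise}}=0$. The secret is encoded as $c\in\mathcal{C}$, the share vector $\hat{c}$ is chosen uniformly at random from $c+\mathcal{C}^{\mathrm{noise}}$, and party $n\in[N]$ receives $\hat{c}(n)$. The LSSS is $T$-secure if for every set $\mathcal{T}\subseteq[N]$ of $T$ parties the distribution of $(\hat{c}(n))_{n\in\mathcal{T}}$ does not depend on the secret $c$. PIR schemes. A PIR scheme over $\mathbb{F}_q$ with $N$ servers and $L$ fragments per file is a collection of LSSSs $(\mathcal{C}_\ell,\mathcal{C}_\ell^{\mathrm{noise}})$ and $(\mathcal{D}_\ell,\mathcal{D}_\ell^{\mathrm{noise}})$, $\ell\in[L]$, over $\mathbb{F}_q$ with $N$ parties, with one-dimensional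 codes $\mathcal{C}_\ell=\mathrm{span}\{c_\ell\}$ and $\mathcal{D}_\ell=\mathrm{span}\{d_\ell\}$, used in the following protocol and required to be decodable in the sense below. There are $M$ files $s_1,\dots,s_M\in\mathbb{F}_q^L$, $s_m=(s_{m,1},\dots,s_{m,L})$, and the user wants file $s_\mu$, $\mu\in[M]$. Put $q_{m,\ell}=\delta_{m,\mu}$ (Kronecker delta). Choose, independently and uniformly at random, $\hat{s}_{m,\ell}\in s_{m,\ell}c_\ell+\mathcal{C}_\ell^{\mathrm{noise}}$ and $\hat{q}_{m,\ell}\in q_{m,\ell}d_\ell+\mathcal{D}_\ell^{\mathrm{noise}}$ for all $m\in[M]$, $\ell\in[L]$. Server $n$ stores $\hat{s}_{m,\ell}(n)$, receives the query $\hat{q}_{m,\ell}(n)$ (for all $m,\ell$), and responds with $r(n)=\sum_{\ell\in[L]}\sum_{m\in[M]}\hat{s}_{m,\ell}(n)\hat{q}_{m,\ell}(n)$. Decodability: there is a decoding function $\mathbb{F}_q^N\to\mathbb{F}_q^L$ that, for every $M$, every $\mu$, all files and all realizations of the randomness, maps $r=(r(1),\dots,r(N))$ to $s_\mu$. The PIR scheme is $X$-secure if every LSSS $(\mathcal{C}_\ell,\mathcal{C}_\ell^{\mathrm{noise}})$ is $X$-secure, and $T$-private if every LSSS $(\mathcal{D}_\ell,\mathcal{D}_\ell^{\mathrm{noise}})$ is $T$-secure. Its rate is the ratio of the file size to the number of downloaded symbols, $\mathcal{R}=L/N$. *)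

theory Defs
  imports "HOL-Analysis.Analysis" "HOL-Probability.Probability_Mass_Function"
begin

text \<open>
  A finite field is a type \<open>'a :: {field, finite}\<close>; codes of length \<open>N = CARD('n)\<close> are subspaces of
  \<open>'a ^ 'n\<close>. The product \<open>c * d\<close> of vectors is the library's componentwise one, i.e. the star
  product; \<open>A + B\<close>, finite sums of sets and \<open>c +o A\<close> are the elementwise (Minkowski) operations of
  Set_Algebras.
\<close>

definition star_prod ::
    "('a::field ^ 'n::finite) set \<Rightarrow> ('a ^ 'n) set \<Rightarrow> ('a ^ 'n) set"  (infixl "\<star>" 75)
  where "C \<star> D = vec.span {c * d | c d. c \<in> C \<and> d \<in> D}"

definition dual_code :: "('a::field ^ 'n::finite) set \<Rightarrow> ('a ^ 'n) set"
  where "dual_code C = {x. \<forall>c\<in>C. scalar_product c x = 0}"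

definition hamming_dist :: "'a ^ 'n::finite \<Rightarrow> 'a ^ 'n \<Rightarrow> nat"
  where "hamming_dist x y = card {i. x $ i \<noteq> y $ i}"

text \<open>
  The minimum distance is only meaningful for codes with at least two words. The dual of a noise
  code always is such a code if the noise code meets a one-dimensional code trivially, since the
  noise code is then a proper subspace.
\<close>

definition min_dist :: "('a ^ 'n::finite) set \<Rightarrow> nat"
  where "min_dist C = Min {hamming_dist x y | x y. x \<in> C \<and> y \<in> C \<and> x \<noteq> y}"

definition dual_dist :: "('a::field ^ 'n::finite) set \<Rightarrow> nat"
  where "dual_dist C = min_dist (dual_code C)"


definition lsss :: "('a::field ^ 'n::finite) set \<Rightarrow> ('a ^ 'n) set \<Rightarrow> bool"
  where "lsss C Cn \<longleftrightarrow> vec.subspace C \<and> vec.subspace Cn \<and> C \<inter> Cn = {0}"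

definition share_vector ::
    "('a::{field,finite} ^ 'n::finite) set \<Rightarrow> 'a ^ 'n \<Rightarrow> ('a ^ 'n) pmf"
  where "share_vector Cn c = pmf_of_set (c +o Cn)"

definition joint_shares ::
    "('a::{field,finite} ^ 'n::finite) set \<Rightarrow> 'n set \<Rightarrow> 'a ^ 'n \<Rightarrow> ('n \<Rightarrow> 'a) pmf"
  where "joint_shares Cn S c = map_pmf (\<lambda>v. restrict (\<lambda>n. v $ n) S) (share_vector Cn c)"

definition lsss_secure ::
    "nat \<Rightarrow> ('a::{field,finite} ^ 'n::finite) set \<Rightarrow> ('a ^ 'n) set \<Rightarrow> bool"
  where "lsss_secure T C Cn \<longleftrightarrow>
    (\<forall>S :: 'n set. card S = T \<longrightarrow> (\<forall>c\<in>C. \<forall>c'\<in>C. joint_shares Cn S c = joint_shares Cn S c'))"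


text \<open>
  The servers are indexed by \<open>'n\<close> and the fragments of a file by \<open>'l\<close>. The generators \<open>c\<^sub>l\<close>, \<open>d\<^sub>l\<close>
  are part of the data because the protocol uses them.
\<close>

record ('a, 'n, 'l) pir =
  storage_gen :: "'l \<Rightarrow> 'a ^ ('n::finite)"
  storage_noise :: "'l \<Rightarrow> ('a ^ 'n) set"
  query_gen :: "'l \<Rightarrow> 'a ^ 'n"
  query_noise :: "'l \<Rightarrow> ('a ^ 'n) set"

definition storage_code :: "('a::field, 'n::finite, 'l) pir \<Rightarrow> 'l \<Rightarrow> ('a ^ 'n) set"
  where "storage_code P l = vec.span {storage_gen P l}"

definition query_code :: "('a::field, 'n::finite, 'l) pir \<Rightarrow> 'l \<Rightarrow> ('a ^ 'n) set"
  where "query_code P l = vec.span {query_gen P l}"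

text \<open>
  The files are \<open>s 1, \<dots>, s M\<close>. As the encodings are drawn independently and uniformly, a
  realization is an arbitrary choice of one element from each of the cosets.
\<close>

definition stored_realization ::
    "('a::field, 'n::finite, 'l::finite) pir \<Rightarrow> nat \<Rightarrow> (nat \<Rightarrow> 'a ^ 'l) \<Rightarrow> (nat \<Rightarrow> 'l \<Rightarrow> 'a ^ 'n) \<Rightarrow> bool"
  where "stored_realization P M s sh \<longleftrightarrow>
    (\<forall>m\<in>{1..M}. \<forall>l. sh m l \<in> (s m $ l *s storage_gen P l) +o storage_noise P l)"

definition query_realization ::
    "('a::field, 'n::finite, 'l) pir \<Rightarrow> nat \<Rightarrow> nat \<Rightarrow> (nat \<Rightarrow> 'l \<Rightarrow> 'a ^ 'n) \<Rightarrow> bool"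
  where "query_realization P M \<mu> qh \<longleftrightarrow>
    (\<forall>m\<in>{1..M}. \<forall>l. qh m l \<in> ((if m = \<mu> then 1 else 0) *s query_gen P l) +o query_noise P l)"

definition response ::
    "nat \<Rightarrow> (nat \<Rightarrow> 'l::finite \<Rightarrow> 'a::field ^ 'n::finite) \<Rightarrow> (nat \<Rightarrow> 'l \<Rightarrow> 'a ^ 'n) \<Rightarrow> 'a ^ 'n"
  where "response M sh qh = (\<chi> n. \<Sum>l\<in>UNIV. \<Sum>m\<in>{1..M}. sh m l $ n * qh m l $ n)"

definition pir_decodable :: "('a::field, 'n::finite, 'l::finite) pir \<Rightarrow> bool"
  where "pir_decodable P \<longleftrightarrow>
    (\<exists>dec :: 'a ^ 'n \<Rightarrow> 'a ^ 'l. \<forall>M. \<forall>\<mu>\<in>{1..M}. \<forall>s sh qh.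
       stored_realization P M s sh \<longrightarrow> query_realization P M \<mu> qh \<longrightarrow>
       dec (response M sh qh) = s \<mu>)"

definition pir_scheme :: "('a::field, 'n::finite, 'l::finite) pir \<Rightarrow> bool"
  where "pir_scheme P \<longleftrightarrow>
    (\<forall>l. lsss (storage_code P l) (storage_noise P l) \<and> vec.dim (storage_code P l) = 1) \<and>
    (\<forall>l. lsss (query_code P l) (query_noise P l) \<and> vec.dim (query_code P l) = 1) \<and>
    pir_decodable P"

definition pir_secure :: "nat \<Rightarrow> ('a::{field,finite}, 'n::finite, 'l) pir \<Rightarrow> bool"
  where "pir_secure X P \<longleftrightarrow> (\<forall>l. lsss_secure X (storage_code P l) (storage_noise P l))"

definition pir_private :: "nat \<Rightarrow> ('a::{field,finite}, 'n::finite, 'l) pir \<Rightarrow> bool"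
  where "pir_private T P \<longleftrightarrow> (\<forall>l. lsss_secure T (query_code P l) (query_noise P l))"

text \<open>
  A file consists of \<open>CARD('l)\<close> field elements, and each of the \<open>CARD('n)\<close> servers returns one.
\<close>

definition pir_rate :: "('a, 'n::finite, 'l::finite) pir \<Rightarrow> real"
  where "pir_rate P = real CARD('l) / real CARD('n)"

end

theory Submission
  imports Defs
begin

text \<open>
  Modulo the noise space, the response is \<open>\<Sum>\<^sub>l s\<^sub>\<mu>\<^sub>,\<^sub>l c\<^sub>l \<star> d\<^sub>l\<close>. The \<open>L\<close> products \<open>c\<^sub>l \<star> d\<^sub>l\<close> span \<open>E\<close>, which has
  dimension \<open>L\<close>, so they are independent, and since \<open>E\<close> meets the noise space trivially the
  coefficients can be read off. For security, a nonzero functional on the coordinates in \<open>S\<close> that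
  vanishes on the noise code is a dual codeword of weight at most \<open>card S\<close>; below the dual distance
  there is none, so the noise attains every value on \<open>S\<close> and a translation by a noise word matches
  the shares of any two secrets.
\<close>

section \<open>Minkowski sums of subspaces\<close>

lemma subspace_set_plus:
  fixes A B :: "('a::field ^ 'n::finite) set"
  assumes "vec.subspace A" "vec.subspace B"
  shows "vec.subspace (A + B)"
proof -
  have "A + B = {x + y |x y. x \<in> A \<and> y \<in> B}"
    by (auto simp: set_plus_def)
  then show ?thesis
    using vec.subspace_sums[OF assms] by simp
qed

lemma subspace_set_sum:
  fixes A :: "'i \<Rightarrow> ('a::field ^ 'n::finite) set"
  assumes "finite I" "\<And>i. i \<in> I \<Longrightarrow> vec.subspace (A i)"
  shows "vec.subspace (\<Sum>i\<in>I. A i)"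
  using assms by (induction I rule: finite_induct) (auto intro: subspace_set_plus)

lemma subset_set_plus_left:
  fixes A B :: "'a::comm_monoid_add set"
  assumes "0 \<in> B"
  shows "A \<subseteq> A + B"
  using assms by (metis add.right_neutral set_plus_intro subsetI)

lemma subset_set_plus_right:
  fixes A B :: "'a::comm_monoid_add set"
  assumes "0 \<in> A"
  shows "B \<subseteq> A + B"
  using subset_set_plus_left[OF assms, of B] by (simp add: add.commute)

lemma subset_set_sum:
  fixes A :: "'i \<Rightarrow> 'a::comm_monoid_add set"
  assumes "finite I" "i \<in> I" "\<And>i. i \<in> I \<Longrightarrow> 0 \<in> A i"
  shows "A i \<subseteq> (\<Sum>i\<in>I. A i)"
proof -
  have "0 \<in> (\<Sum>j\<in>I - {i}. A j)"
    using assms by (subst set_sum_alt) (auto intro!: exI[of _ "\<lambda>_. 0"])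
  then show ?thesis
    using assms by (simp add: sum.remove[of I i] subset_set_plus_left)
qed

section \<open>Star products and one-dimensional codes\<close>

lemma subspace_star_prod: "vec.subspace (A \<star> B)"
  by (simp add: star_prod_def)

lemma mult_in_star_prod: "c \<in> A \<Longrightarrow> d \<in> B \<Longrightarrow> c * d \<in> A \<star> B"
  unfolding star_prod_def by (intro vec.span_base) auto

text \<open>The scalars of both factors can be pulled out of a componentwise product. This reduces
  each summand of \<open>E\<close> to multiples of one vector.\<close>

lemma star_prod_span_singleton:
  fixes c d :: "'a::field ^ 'n::finite"
  shows "vec.span {c} \<star> vec.span {d} \<subseteq> vec.span {c * d}"
proof -
  have "{x * y |x y. x \<in> vec.span {c} \<and> y \<in> vec.span {d}} \<subseteq> vec.span {c * d}"
  proof clarify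
    fix x y assume "x \<in> vec.span {c}" "y \<in> vec.span {d}"
    then obtain a b where "x = a *s c" "y = b *s d"
      by (auto simp: vec.span_singleton)
    then have "x * y = (a * b) *s (c * d)"
      by (simp add: vec_eq_iff)
    then show "x * y \<in> vec.span {c * d}"
      by (auto simp: vec.span_singleton)
  qed
  then show ?thesis
    unfolding star_prod_def by (intro vec.span_minimal) auto
qed

lemma dim_1_generator:
  fixes A :: "('a::field ^ 'n::finite) set"
  assumes "vec.subspace A" "vec.dim A = 1"
  obtains c where "A = vec.span {c}"
proof -
  obtain B where B: "B \<subseteq> A" "A \<subseteq> vec.span B" "card B = 1"
    using vec.basis_exists[of A] assms(2) by metis
  obtain c where "B = {c}"
    using B(3) by (auto simp: card_1_singleton_iff)
  with B(1,2) show thesis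
    using vec.span_minimal[OF B(1) assms(1)] that by blast
qed

section \<open>Security and the dual distance\<close>

text \<open>A linear map can vanish on \<open>W\<close> but not at \<open>v\<close>; a row of its
  matrix then represents a functional that is a nonzero dual codeword.\<close>

lemma exists_dual_vector:
  fixes W :: "('a::field ^ 'n::finite) set"
  assumes "vec.subspace W" "v \<notin> W"
  shows "\<exists>x\<in>dual_code W. x \<noteq> 0"
proof -
  obtain B where B: "B \<subseteq> W" "vec.independent B" "W \<subseteq> vec.span B"
    using vec.basis_exists[of W] by metis
  have "v \<notin> vec.span B"
    using B(1) assms vec.span_minimal by blast
  then have indep: "vec.independent (insert v B)"
    using B(2) by (simp add: vec.independent_insert)
  \<comment> \<open>Here \<open>1\<close> is the all-ones vector, so every coordinate of
    \<open>f v\<close> is nonzero and any row of the matrix serves; hence the arbitrary index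
    \<open>i\<close> below.\<close>
  obtain f where f: "Vector_Spaces.linear (*s) (*s) f"
    "\<forall>b\<in>insert v B. f b = (if b = v then 1 else 0 :: 'a ^ 'n)"
    using vec.linear_independent_extend[OF indep, of "\<lambda>b. if b = v then 1 else 0 :: 'a ^ 'n"] by blast
  have f0: "f w = 0" if "w \<in> W" for w
  proof -
    have "\<And>b. b \<in> B \<Longrightarrow> f b = 0"
      using f(2) B(1) assms(2) by auto
    then show ?thesis
      using vec.linear_eq_0_on_span[OF f(1)] B(3) that by blast
  qed
  define i :: 'n where "i = undefined"
  define x where "x = matrix f $ i"
  have fx: "f w $ i = scalar_product w x" for w
    by (simp add: matrix_works[OF f(1), symmetric] matrix_vector_mult_def scalar_product_def x_def mult.commute)
  have "x \<in> dual_code W"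
    using f0 by (simp add: dual_code_def flip: fx)
  moreover have "scalar_product v x \<noteq> 0"
    using f(2) by (simp flip: fx)
  then have "x \<noteq> 0"
    by (auto simp: scalar_product_def)
  ultimately show ?thesis by blast
qed

text \<open>The distances form a finite nonempty set of positive numbers, so their minimum is
  attained. Positivity excludes the degenerate case of the truncated subtraction in
  \<open>dual_dist Cn - 1\<close>.\<close>

lemma min_dist_bounds:
  fixes A :: "('a ^ 'n::finite) set"
  assumes "x \<in> A" "y \<in> A" "x \<noteq> y"
  shows "min_dist A \<le> hamming_dist x y" "0 < min_dist A"
proof -
  let ?H = "{hamming_dist x y |x y. x \<in> A \<and> y \<in> A \<and> x \<noteq> y}"
  have "hamming_dist x y \<le> CARD('n)" for x y :: "'a ^ 'n"
    unfolding hamming_dist_def by (intro card_mono) auto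
  then have fin: "finite ?H"
    by (intro finite_subset[OF _ finite_atMost[of "CARD('n)"]]) auto
  have mem: "hamming_dist x y \<in> ?H"
    using assms by blast
  show "min_dist A \<le> hamming_dist x y"
    unfolding min_dist_def using fin mem by (rule Min_le)
  have "0 < h" if "h \<in> ?H" for h
    using that by (auto simp: hamming_dist_def card_gt_0_iff vec_eq_iff)
  moreover have "Min ?H \<in> ?H"
    using fin mem by (intro Min_in) auto
  ultimately show "0 < min_dist A"
    unfolding min_dist_def by blast
qed

lemma noise_interpolates:
  fixes Cn :: "('a::field ^ 'n::finite) set"
  assumes "vec.subspace Cn" "card S \<le> dual_dist Cn - 1"
  obtains w where "w \<in> Cn" "\<And>i. i \<in> S \<Longrightarrow> w $ i = v $ i"
proof -
  \<comment> \<open>\<open>K\<close> is the kernel of restriction to \<open>S\<close>, so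
    interpolating \<open>v\<close> on \<open>S\<close> means writing \<open>v\<close> as a noise
    word plus an element of \<open>K\<close>.\<close>
  define K where "K = {u :: 'a ^ 'n. \<forall>i\<in>S. u $ i = 0}"
  have K: "vec.subspace K"
    by (auto simp: K_def vec.subspace_def)
  have "v \<in> Cn + K"
  proof (rule ccontr)
    assume "v \<notin> Cn + K"
    then obtain x where x: "x \<in> dual_code (Cn + K)" "x \<noteq> 0"
      using exists_dual_vector subspace_set_plus[OF assms(1) K] by blast
    have sub: "Cn \<subseteq> Cn + K" "K \<subseteq> Cn + K"
      using assms(1) K by (auto intro!: subset_set_plus_left subset_set_plus_right vec.subspace_0)
    have xC: "x \<in> dual_code Cn"
      using x(1) sub(1) by (auto simp: dual_code_def)
    have "x $ i = 0" if "i \<notin> S" for i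
    proof -
      \<comment> \<open>Orthogonality to the unit vectors outside \<open>S\<close> confines the
        support of \<open>x\<close> to \<open>S\<close>.\<close>
      have "axis i 1 \<in> K"
        using that by (auto simp: K_def axis_def)
      then have "scalar_product (axis i 1) x = 0"
        using x(1) sub(2) by (auto simp: dual_code_def)
      then show ?thesis
        by (simp add: scalar_product_def axis_def if_distrib if_distribR cong: if_cong)
    qed
    then have "hamming_dist x 0 \<le> card S"
      unfolding hamming_dist_def by (intro card_mono) auto
    moreover have "0 \<in> dual_code Cn"
      by (simp add: dual_code_def scalar_product_def)
    ultimately show False
      using min_dist_bounds[OF xC _ x(2)] assms(2) by (auto simp: dual_dist_def)
  qed
  then obtain w u where "w \<in> Cn" "u \<in> K" "v = w + u"
    by (auto elim: set_plus_elim)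
  then show thesis
    by (intro that[of w]) (auto simp: K_def)
qed

text \<open>Allowing every \<open>T\<close> up to the bound lets one threshold, the minimum over all
  fragments, serve each of them.\<close>

lemma lsss_secure_dual_dist:
  fixes C Cn :: "('a::{field,finite} ^ 'n::finite) set"
  assumes "vec.subspace Cn" "T \<le> dual_dist Cn - 1"
  shows "lsss_secure T C Cn"
  unfolding lsss_secure_def
proof (intro allI impI ballI)
  fix S :: "'n set" and c c'
  assume "card S = T"
  with assms obtain w where w: "w \<in> Cn" "\<And>i. i \<in> S \<Longrightarrow> w $ i = (c' - c) $ i"
    using noise_interpolates[of Cn S "c' - c"] by blast
  \<comment> \<open>The shift vanishes on \<open>S\<close> by the choice of \<open>w\<close>, yet
    carries the coset of \<open>c\<close> onto that of \<open>c'\<close> because \<open>w\<close> is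
    noise.\<close>
  define t where "t = (\<lambda>x. x + (c' - c - w))"
  have ne: "c +o Cn \<noteq> {}"
    using vec.subspace_0[OF assms(1)] by (auto simp: elt_set_plus_def)
  have "t ` (c +o Cn) = c' +o Cn"
  proof (intro equalityI subsetI)
    fix y assume "y \<in> t ` (c +o Cn)"
    then obtain u where "u \<in> Cn" "y = t (c + u)"
      by (auto simp: elt_set_plus_def)
    then show "y \<in> c' +o Cn"
      using vec.subspace_diff[OF assms(1) \<open>u \<in> Cn\<close> w(1)]
      by (auto simp: elt_set_plus_def t_def algebra_simps intro!: bexI[of _ "u - w"])
  next
    fix y assume "y \<in> c' +o Cn"
    then obtain u where "u \<in> Cn" "y = c' + u"
      by (auto simp: elt_set_plus_def)
    then have "y = t (c + (u + w))" "c + (u + w) \<in> c +o Cn"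
      using vec.subspace_add[OF assms(1) \<open>u \<in> Cn\<close> w(1)]
      by (auto simp: elt_set_plus_def t_def algebra_simps)
    then show "y \<in> t ` (c +o Cn)"
      by blast
  qed
  moreover have "inj_on t (c +o Cn)"
    by (auto simp: t_def inj_on_def)
  ultimately have "share_vector Cn c' = map_pmf t (share_vector Cn c)"
    unfolding share_vector_def using ne by (simp add: map_pmf_of_set_inj)
  moreover have "restrict (\<lambda>n. t x $ n) S = restrict (\<lambda>n. x $ n) S" for x
    using w(2) by (auto simp: t_def restrict_def)
  ultimately show "joint_shares Cn S c = joint_shares Cn S c'"
    by (simp add: joint_shares_def map_pmf_comp)
qed

section \<open>Decodability\<close>

text \<open>The dimension forces the family to be injective, and its range is then a spanning set of
  minimal size. Coefficients are moved to the range through \<open>inv b\<close>.\<close>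

lemma independent_family:
  fixes b :: "'l::finite \<Rightarrow> 'a::field ^ 'n::finite"
  assumes dim: "vec.dim (vec.span (range b)) = CARD('l)"
    and zero: "(\<Sum>l\<in>UNIV. a l *s b l) = 0"
  shows "a l = 0"
proof -
  have "CARD('l) \<le> card (range b)"
    using vec.dim_le_card'[of "range b"] dim by (simp add: vec.dim_span)
  then have card: "card (range b) = CARD('l)"
    using card_image_le[of UNIV b] by simp
  then have inj: "inj b"
    by (simp add: eq_card_imp_inj_on)
  have "vec.independent (range b)"
    using card dim by (intro vec.card_le_dim_spanning[of _ "vec.span (range b)"]) (auto simp: vec.span_superset)
  moreover have "(\<Sum>v\<in>range b. a (inv b v) *s v) = 0"
    using zero inj by (simp add: sum.reindex inv_f_f)
  ultimately have "a (inv b (b l)) = 0"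
    by (intro vec.independentD[of "range b" "range b" "\<lambda>v. a (inv b v)"]) auto
  then show ?thesis
    using inj by (simp add: inv_f_f)
qed

text \<open>\<open>V\<close> abstracts the noise space: it need only absorb the three kinds of
  product that involve noise.\<close>

lemma pir_decodable_if_noise_separated:
  fixes P :: "('a::field, 'n::finite, 'l::finite) pir"
  defines "b \<equiv> \<lambda>l. storage_gen P l * query_gen P l"
  assumes V: "vec.subspace V"
    and V1: "\<And>l w. w \<in> query_noise P l \<Longrightarrow> storage_gen P l * w \<in> V"
    and V2: "\<And>l u. u \<in> storage_noise P l \<Longrightarrow> u * query_gen P l \<in> V"
    and V3: "\<And>l u w. u \<in> storage_noise P l \<Longrightarrow> w \<in> query_noise P l \<Longrightarrow> u * w \<in> V"
    and sep: "vec.span (range b) \<inter> V \<subseteq> {0}"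
    and dim: "vec.dim (vec.span (range b)) = CARD('l)"
  shows "pir_decodable P"
proof -
  define comb where "comb x = (\<Sum>l\<in>UNIV. x $ l *s b l)" for x :: "'a ^ 'l"
  have comb_span: "comb x \<in> vec.span (range b)" for x
    unfolding comb_def by (intro vec.span_sum vec.span_scale vec.span_base) auto
  have comb_diff: "comb x - comb y = comb (x - y)" for x y
    by (simp add: comb_def vec.scale_left_diff_distrib sum_subtractf)
  have unique: "x = y" if "r - comb x \<in> V" "r - comb y \<in> V" for r x y
  proof -
    have "comb (x - y) \<in> V"
      using vec.subspace_diff[OF V that(2,1)] by (simp add: comb_diff)
    then have "comb (x - y) = 0"
      using sep comb_span by blast
    then have "(x - y) $ l = 0" for l
      unfolding comb_def by (rule independent_family[OF dim])
    then show ?thesis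
      by (simp add: vec_eq_iff)
  qed
  have resp: "response M sh qh - comb (s \<mu>) \<in> V"
    if \<mu>: "\<mu> \<in> {1..M}" and sh: "stored_realization P M s sh" and qh: "query_realization P M \<mu> qh"
    for M \<mu> s sh qh
  proof -
    have term_in: "sh m l * qh m l - (if m = \<mu> then s m $ l *s b l else 0) \<in> V" if m: "m \<in> {1..M}" for m l
    proof -
      obtain u where u: "u \<in> storage_noise P l" "sh m l = s m $ l *s storage_gen P l + u"
        using sh m unfolding stored_realization_def elt_set_plus_def by blast
      obtain w where w: "w \<in> query_noise P l"
        "qh m l = (if m = \<mu> then 1 else 0) *s query_gen P l + w"
        using qh m unfolding query_realization_def elt_set_plus_def by blast
      let ?q = "if m = \<mu> then 1 else 0 :: 'a"
      \<comment> \<open>Expanding the product leaves the single noise-free term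
        \<open>s m $ l *s b l\<close>, and only for the wanted file.\<close>
      have "sh m l * qh m l - (if m = \<mu> then s m $ l *s b l else 0) =
          s m $ l *s (storage_gen P l * w) + ?q *s (u * query_gen P l) + u * w"
        by (simp add: u w b_def vec_eq_iff algebra_simps)
      also have "\<dots> \<in> V"
        using V u(1) w(1) by (intro vec.subspace_add vec.subspace_scale V1 V2 V3)
      finally show ?thesis .
    qed
    have "response M sh qh = (\<Sum>l\<in>UNIV. \<Sum>m\<in>{1..M}. sh m l * qh m l)"
      by (simp add: response_def vec_eq_iff)
    moreover have "comb (s \<mu>) = (\<Sum>l\<in>UNIV. \<Sum>m\<in>{1..M}. if m = \<mu> then s m $ l *s b l else 0)"
      using \<mu> by (simp add: comb_def)
    ultimately have "response M sh qh - comb (s \<mu>) =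
        (\<Sum>l\<in>UNIV. \<Sum>m\<in>{1..M}. sh m l * qh m l - (if m = \<mu> then s m $ l *s b l else 0))"
      by (simp add: sum_subtractf)
    also have "\<dots> \<in> V"
      by (intro vec.subspace_sum V term_in)
    finally show ?thesis .
  qed
  show ?thesis
    unfolding pir_decodable_def
  \<comment> \<open>This decoder depends only on \<open>comb\<close> and \<open>V\<close>, so one
    function works for all \<open>M\<close>, \<mu>, files and randomness.\<close>
  proof (intro exI[of _ "\<lambda>r. THE x. r - comb x \<in> V"] allI ballI impI)
    fix M \<mu> s sh qh
    assume "\<mu> \<in> {1..M}" "stored_realization P M s sh" "query_realization P M \<mu> qh"
    then have "response M sh qh - comb (s \<mu>) \<in> V"
      by (rule resp)
    then show "(THE x. response M sh qh - comb x \<in> V) = s \<mu>"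
      using unique by (intro the_equality) auto
  qed
qed

theorem mainTheorem1:
  fixes C Cn D Dn :: "'l::finite \<Rightarrow> ('a::{field,finite} ^ 'n::finite) set"
    and E En :: "('a ^ 'n) set"
  assumes "\<And>l. lsss (C l) (Cn l)" and "\<And>l. lsss (D l) (Dn l)"
    and "\<And>l. vec.dim (C l) = 1" and "\<And>l. vec.dim (D l) = 1"
    and "E = (\<Sum>l\<in>UNIV. C l \<star> D l)"
    and "En = (\<Sum>l\<in>UNIV. C l \<star> Dn l + Cn l \<star> D l + Cn l \<star> Dn l)"
    and "E \<inter> En = {0}"
    and "vec.dim E = CARD('l)"
  shows "\<exists>P :: ('a, 'n, 'l) pir.
    pir_scheme P \<and>
    pir_rate P = real CARD('l) / real CARD('n) \<and>
    pir_secure ((MIN l. dual_dist (Cn l)) - 1) P \<and>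
    pir_private ((MIN l. dual_dist (Dn l)) - 1) P"
proof -
  have "\<exists>c. C l = vec.span {c}" "\<exists>d. D l = vec.span {d}" for l
    using assms(1-4)[of l] dim_1_generator by (metis lsss_def)+
  then obtain c d where c: "\<And>l. C l = vec.span {c l}" and d: "\<And>l. D l = vec.span {d l}"
    by metis
  have noise: "vec.subspace (Cn l)" "vec.subspace (Dn l)" for l
    using assms(1,2)[of l] by (auto simp: lsss_def)
  define P where "P = \<lparr>storage_gen = c, storage_noise = Cn, query_gen = d, query_noise = Dn\<rparr>"
  note star_0 = vec.subspace_0[OF subspace_star_prod]
  let ?N = "\<lambda>l. C l \<star> Dn l + Cn l \<star> D l + Cn l \<star> Dn l"
  have N: "vec.subspace (?N l)" for l
    by (intro subspace_set_plus subspace_star_prod)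
  have En: "vec.subspace En"
    unfolding assms(6) by (intro subspace_set_sum N) simp
  have "?N l \<subseteq> En" for l
    unfolding assms(6) by (rule subset_set_sum[of UNIV l ?N]) (auto intro: vec.subspace_0[OF N])
  moreover have "C l \<star> Dn l + Cn l \<star> D l \<subseteq> ?N l" "Cn l \<star> Dn l \<subseteq> ?N l"
    "C l \<star> Dn l \<subseteq> C l \<star> Dn l + Cn l \<star> D l" "Cn l \<star> D l \<subseteq> C l \<star> Dn l + Cn l \<star> D l" for l
    by (intro subset_set_plus_left subset_set_plus_right star_0
        vec.subspace_0[OF subspace_set_plus] subspace_star_prod)+
  ultimately have sub: "C l \<star> Dn l \<subseteq> En" "Cn l \<star> D l \<subseteq> En" "Cn l \<star> Dn l \<subseteq> En" for l
    by blast+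
  have cC: "c l \<in> C l" and dD: "d l \<in> D l" for l
    by (auto simp: c d vec.span_base)
  \<comment> \<open>This turns the hypotheses on \<open>E\<close> into the separation and dimension
    conditions for the products of the generators.\<close>
  have "E = vec.span (range (\<lambda>l. c l * d l))"
  proof (rule antisym)
    have "C l \<star> D l \<subseteq> vec.span (range (\<lambda>l. c l * d l))" for l
      using star_prod_span_singleton[of "c l" "d l"] vec.span_mono[of "{c l * d l}" "range (\<lambda>l. c l * d l)"]
      unfolding c d by blast
    then show "E \<subseteq> vec.span (range (\<lambda>l. c l * d l))"
      unfolding assms(5) set_sum_alt[OF finite] by (auto intro!: vec.span_sum)
    have "vec.subspace E"
      unfolding assms(5) by (intro subspace_set_sum subspace_star_prod) simp
    moreover have "C l \<star> D l \<subseteq> E" for l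
      unfolding assms(5) by (rule subset_set_sum[of UNIV l "\<lambda>l. C l \<star> D l"]) (auto intro: star_0)
    then have "range (\<lambda>l. c l * d l) \<subseteq> E"
      using mult_in_star_prod[OF cC dD] by blast
    ultimately show "vec.span (range (\<lambda>l. c l * d l)) \<subseteq> E"
      by (intro vec.span_minimal)
  qed
  then have "pir_decodable P"
    using assms(7,8) sub mult_in_star_prod cC dD
    by (intro pir_decodable_if_noise_separated[OF En]) (auto simp: P_def, blast+)
  then have "pir_scheme P"
    using assms(1-4) by (simp add: pir_scheme_def P_def storage_code_def query_code_def flip: c d)
  \<comment> \<open>The minimum is at most each dual distance, and subtracting one is
    monotone.\<close>
  moreover have "pir_secure ((MIN l. dual_dist (Cn l)) - 1) P"
    unfolding pir_secure_def P_def
    by (auto intro!: lsss_secure_dual_dist noise diff_le_mono)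
  moreover have "pir_private ((MIN l. dual_dist (Dn l)) - 1) P"
    unfolding pir_private_def P_def
    by (auto intro!: lsss_secure_dual_dist noise diff_le_mono)
  ultimately show ?thesis
    by (intro exI[of _ P]) (simp add: pir_rate_def)
qed

end
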